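(* Let $G=(V,E)$ be a connected graph on $n$ vertices with radius $r\geq 3$ and maximum vertex degree $\Delta$. Then \[\bar{\mathsf{C}}_C(G)\leq \frac{n-1}{2n-1-\Delta+r(r-3)/2}.\]
   Context: For vertices $u,v$ of a connected graph $G=(V,E)$ with $|V|=n\ge2$, $d(u,v)$ is the distance between $u$ and $v$. The (normalised) closeness centrality of a vertex $v$ is $\bar{\mathsf{C}}_C(v)=\dfrac{n-1}{\sum_{w\in V}d(v,w)}$, and the closeness centrality of $G$ is $\bar{\mathsf{C}}_C(G)=\dfrac{1}{n}\sum_{v\in V}\bar{\mathsf{C}}_C(v)$. The eccentricity $\epsilon(v)$ of a vertex $v$ is $\max_{u\in V}d(u,v)$, and the radius of $G$ is $r=\min_{v\in V}\epsilon(v)$. *)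

theory Defs
  imports "Graph_Theory.Graph_Theory"
begin

text \<open>
  A finite simple undirected graph is a digraph in the locale \<^locale>\<open>graph\<close>: finite, loop-free,
  without parallel arcs and with symmetric arc relation. Each undirected edge is thus a pair of
  opposite arcs, and the degree of a vertex is its \<^const>\<open>out_degree\<close>.
\<close>

definition graph_dist :: "('a, 'b) pre_digraph \<Rightarrow> 'a \<Rightarrow> 'a \<Rightarrow> nat" where
  "graph_dist G u v = (LEAST k. \<exists>p. pre_digraph.awalk G u p v \<and> length p = k)"

definition closeness :: "('a, 'b) pre_digraph \<Rightarrow> 'a \<Rightarrow> real" where
  "closeness G v = (real (card (verts G)) - 1) / (\<Sum>w\<in>verts G. real (graph_dist G v w))"

definition graph_closeness :: "('a, 'b) pre_digraph \<Rightarrow> real" where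
  "graph_closeness G = (1 / real (card (verts G))) * (\<Sum>v\<in>verts G. closeness G v)"

definition eccentricity :: "('a, 'b) pre_digraph \<Rightarrow> 'a \<Rightarrow> nat" where
  "eccentricity G v = Max ((\<lambda>u. graph_dist G u v) ` verts G)"

definition radius :: "('a, 'b) pre_digraph \<Rightarrow> nat" where
  "radius G = Min (eccentricity G ` verts G)"

definition max_degree :: "('a, 'b) pre_digraph \<Rightarrow> nat" where
  "max_degree G = Max (out_degree G ` verts G)"

text \<open>The least walk length agrees with the library's shortest-path cost for unit weights.\<close>

lemma (in wf_digraph) graph_dist_eq_mu:
  assumes "u \<rightarrow>\<^sup>* v"
  shows "ereal (real (graph_dist G u v)) = \<mu> (\<lambda>_. 1) u v"
proof -
  have cost: "awalk_cost (\<lambda>_. 1) p = real (length p)" for p :: "'b list"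
    by (simp add: awalk_cost_def sum_list_triv)
  from assms obtain q where "awalk u q v" by (auto simp: reachable_awalk)
  then have "\<exists>k p. awalk u p v \<and> length p = k" by blast
  then have "\<exists>p. awalk u p v \<and> length p = graph_dist G u v"
    unfolding graph_dist_def by (rule LeastI_ex)
  then obtain p where p: "awalk u p v" "length p = graph_dist G u v" by blast
  have le: "graph_dist G u v \<le> length p'" if "awalk u p' v" for p'
    unfolding graph_dist_def using that by (blast intro: Least_le)
  show ?thesis
    unfolding \<mu>_def cost
    by (rule antisym) (use p le in \<open>auto intro!: INF_greatest INF_lower2[of p]\<close>)
qed

end

theory Submission
  imports Defs
begin

text \<open>
  The distances from a vertex \<open>v\<close> take every value up to its eccentricity, hence every value up
  to the radius \<open>r\<close>. Counting each vertex with weight 2, correcting for \<open>v\<close> itself and for its at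
  most \<open>\<Delta>\<close> neighbours, and adding the excess \<open>i - 2\<close> for one vertex at each distance
  \<open>3 \<le> i \<le> r\<close>, the sum of all distances from \<open>v\<close> is at least
  \<open>2n - 2 - \<Delta> + (r - 1)(r - 2)/2\<close>. So the bound holds for the closeness of each single vertex, and
  therefore for the average.
\<close>

lemma (in wf_digraph) graph_dist_le:
  assumes "awalk u p v"
  shows "graph_dist G u v \<le> length p"
  unfolding graph_dist_def using assms by (blast intro: Least_le)

lemma (in wf_digraph) shortest_awalk_exists:
  assumes "u \<rightarrow>\<^sup>* v"
  obtains p where "awalk u p v" "length p = graph_dist G u v"
proof -
  from assms obtain q where "awalk u q v" by (auto simp: reachable_awalk)
  then have "\<exists>k p. awalk u p v \<and> length p = k" by blast
  then have "\<exists>p. awalk u p v \<and> length p = graph_dist G u v"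
    unfolding graph_dist_def by (rule LeastI_ex)
  then show ?thesis using that by blast
qed

lemma (in wf_digraph) graph_dist_refl:
  assumes "v \<in> verts G"
  shows "graph_dist G v v = 0"
  using graph_dist_le[of v "[]" v] assms by (simp add: awalk_Nil_iff)

lemma (in wf_digraph) graph_dist_eq_0:
  assumes "u \<rightarrow>\<^sup>* v" "graph_dist G u v = 0"
  shows "u = v"
  using shortest_awalk_exists[OF assms(1)] assms(2) by (metis awalk_Nil_iff length_0_conv)

lemma (in wf_digraph) graph_dist_eq_1:
  assumes "u \<rightarrow>\<^sup>* v" "graph_dist G u v = 1"
  shows "v \<in> head G ` out_arcs G u"
proof -
  obtain p where p: "awalk u p v" "length p = 1"
    using shortest_awalk_exists[OF assms(1)] assms(2) by metis
  then obtain e where "p = [e]" by (auto simp: length_Suc_conv)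
  with p show ?thesis by (auto simp: awalk_simps)
qed

text \<open>Cut a shortest walk to \<open>v\<close> after \<open>k\<close> arcs, at
  \<open>w\<close>. The prefix bounds the distance of \<open>w\<close> by \<open>k\<close>; a
  shorter walk to \<open>w\<close>, continued by the suffix, would undercut the distance of
  \<open>v\<close>.\<close>

lemma (in wf_digraph) graph_dist_attains:
  assumes "u \<rightarrow>\<^sup>* v" "k \<le> graph_dist G u v"
  obtains w where "w \<in> verts G" "graph_dist G u w = k"
proof -
  obtain p where p: "awalk u p v" "length p = graph_dist G u v"
    using shortest_awalk_exists[OF assms(1)] .
  define w where "w = awlast u (take k p)"
  have "awalk u (take k p @ drop k p) v" using p(1) by simp
  then have w: "awalk u (take k p) w" "awalk w (drop k p) v"
    unfolding awalk_append_iff w_def by auto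
  then have "u \<rightarrow>\<^sup>* w" by (auto simp: reachable_awalk)
  then obtain q where q: "awalk u q w" "length q = graph_dist G u w"
    using shortest_awalk_exists by blast
  have "graph_dist G u v \<le> length (q @ drop k p)"
    using q(1) w(2) by (intro graph_dist_le awalk_appendI)
  then have "k \<le> graph_dist G u w" using q(2) p(2) assms(2) by simp
  moreover have "graph_dist G u w \<le> k"
    using graph_dist_le[OF w(1)] p(2) assms(2) by simp
  ultimately show ?thesis using that[of w] w(2) by (auto dest: awalk_hd_in_verts)
qed

lemma (in sym_digraph) awalk_reverse:
  assumes "awalk u p v"
  shows "\<exists>q. awalk v q u \<and> length q = length p"
  using assms
proof (induction p arbitrary: u)
  case Nil
  then show ?case by (auto simp: awalk_Nil_iff)
next
  case (Cons e p)
  then have e: "e \<in> arcs G" "u = tail G e" and "awalk (head G e) p v"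
    by (auto simp: awalk_Cons_iff)
  then obtain q where q: "awalk v q (head G e)" "length q = length p"
    using Cons.IH by blast
  obtain e' where e': "e' \<in> arcs G" "tail G e = head G e'" "head G e = tail G e'"
    using sym_arcs e(1) unfolding symmetric_conv by blast
  then have "awalk (head G e) [e'] u" using e by (auto simp: awalk_simps)
  with q have "awalk v (q @ [e']) u" by (blast intro: awalk_appendI)
  with q(2) show ?case by (intro exI[of _ "q @ [e']"]) simp
qed

text \<open>Bridges two conventions: \<open>eccentricity\<close> measures distances towards a
  vertex, \<open>closeness\<close> distances away from it.\<close>

lemma (in sym_digraph) graph_dist_sym: "graph_dist G u v = graph_dist G v u"
proof -
  have "(\<exists>p. awalk u p v \<and> length p = k) \<longleftrightarrow> (\<exists>p. awalk v p u \<and> length p = k)" for k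
    using awalk_reverse by metis
  then show ?thesis unfolding graph_dist_def by simp
qed

lemma (in sym_digraph) connected_reachable:
  assumes "Digraph_Component.connected G" "u \<in> verts G" "v \<in> verts G"
  shows "u \<rightarrow>\<^sup>* v"
proof -
  have "u \<rightarrow>\<^sup>*\<^bsub>mk_symmetric G\<^esub> v"
    using assms unfolding connected_def by (auto elim!: strongly_connectedE)
  then show ?thesis using reachable_mk_symmetric_eq[OF sym_arcs] by simp
qed

text \<open>Without parallel arcs the heads of the arcs leaving \<open>v\<close> are distinct, and
  without loops they avoid \<open>v\<close>. This later makes the denominator positive.\<close>

lemma (in digraph) out_degree_less_card_verts:
  assumes "v \<in> verts G"
  shows "out_degree G v < card (verts G)"
proof -
  have "inj_on (head G) (out_arcs G v)"
    by (rule inj_onI) (auto intro!: no_multi_arcs simp: arc_to_ends_def)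
  then have "out_degree G v = card (head G ` out_arcs G v)"
    unfolding out_degree_def by (simp add: card_image)
  also have "\<dots> \<le> card (verts G - {v})"
    by (rule card_mono) (auto dest: no_loops)
  also have "\<dots> < card (verts G)"
    using assms by (intro psubset_card_mono) auto
  finally show ?thesis .
qed

text \<open>Subtraction on naturals truncates, so the terms for 0, 1 and 2 vanish and 1 + ... + m
  remains.\<close>

lemma sum_diff_2: "(\<Sum>i\<le>Suc (Suc m). real (i - 2)) = real m * (real m + 1) / 2"
  by (induction m) (auto simp: field_simps)

lemma (in graph) sum_graph_dist_ge:
  assumes conn: "Digraph_Component.connected G" and v: "v \<in> verts G"
    and r: "2 \<le> r" "r \<le> eccentricity G v"
  shows "2 * real (card (verts G)) - 1 - real (out_degree G v) + real r * (real r - 3) / 2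
    \<le> (\<Sum>w\<in>verts G. real (graph_dist G v w))"
proof -
  let ?d = "graph_dist G v"
  have reach: "v \<rightarrow>\<^sup>* w" if "w \<in> verts G" for w
    using connected_reachable[OF conn v that] .
  have zero: "{w \<in> verts G. ?d w = 0} = {v}"
    using v graph_dist_refl graph_dist_eq_0 reach by auto
  have one: "card {w \<in> verts G. ?d w = 1} \<le> out_degree G v"
  proof -
    have "{w \<in> verts G. ?d w = 1} \<subseteq> head G ` out_arcs G v"
      using graph_dist_eq_1 reach by auto
    then have "card {w \<in> verts G. ?d w = 1} \<le> card (head G ` out_arcs G v)"
      by (intro card_mono) auto
    also have "\<dots> \<le> out_degree G v" unfolding out_degree_def by (intro card_image_le) auto
    finally show ?thesis .
  qed
  have "eccentricity G v \<in> (\<lambda>u. graph_dist G u v) ` verts G"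
    unfolding eccentricity_def using v by (intro Max_in) auto
  then obtain u where u: "u \<in> verts G" "?d u = eccentricity G v"
    using graph_dist_sym by force
  have layers: "{..r} \<subseteq> ?d ` verts G"
  proof
    fix k assume "k \<in> {..r}"
    then have "k \<le> ?d u" using u r by simp
    then obtain w where "w \<in> verts G" "?d w = k"
      using graph_dist_attains[OF reach[OF u(1)]] by blast
    then show "k \<in> ?d ` verts G" by blast
  qed
  \<comment> \<open>Here (r - 1)(r - 2)/2 = r(r - 3)/2 + 1; the extra 1 turns 2n - 2 into the 2n - 1
    of the claim.\<close>
  have "real r * (real r - 3) / 2 + 1 = (\<Sum>i\<le>r. real (i - 2))"
    using sum_diff_2[of "r - 2"] r by (simp add: numeral_2_eq_2 Suc_diff_Suc of_nat_diff field_simps)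
  also have "\<dots> \<le> (\<Sum>i\<in>?d ` verts G. real (i - 2))"
    using layers by (intro sum_mono2) auto
  \<comment> \<open>Each distance counts once on the left, but once per vertex attaining it on the
    right.\<close>
  also have "\<dots> \<le> (\<Sum>w\<in>verts G. real (?d w - 2))"
    using sum_image_le[of "verts G" "\<lambda>i. real (i - 2)" ?d] by (simp add: o_def)
  finally have excess: "real r * (real r - 3) / 2 + 1 \<le> (\<Sum>w\<in>verts G. real (?d w - 2))" .
  \<comment> \<open>Pointwise, the weight 2 is corrected by -2 at distance 0 and by -1 at distance
    1; the truncated excess is zero in both cases.\<close>
  have "(\<Sum>w\<in>verts G. real (?d w)) =
      (\<Sum>w\<in>verts G. 2 - 2 * (if ?d w = 0 then 1 else 0) - (if ?d w = 1 then 1 else 0) + real (?d w - 2))"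
    by (intro sum.cong) auto
  also have "\<dots> = 2 * real (card (verts G)) - 2 * real (card {w \<in> verts G. ?d w = 0})
      - real (card {w \<in> verts G. ?d w = 1}) + (\<Sum>w\<in>verts G. real (?d w - 2))"
    by (simp add: sum.distrib sum_subtractf sum_distrib_left[symmetric] sum.If_cases Int_def)
  finally show ?thesis using zero one excess by simp
qed

theorem theorem7:
  fixes G :: "('a, 'b) pre_digraph" and n r \<Delta> :: nat
  assumes "graph G"
    and "Digraph_Component.connected G"
    and "n = card (verts G)"
    and "r = radius G"
    and "r \<ge> 3"
    and "\<Delta> = max_degree G"
  shows "graph_closeness G \<le>
    (real n - 1) / (2 * real n - 1 - real \<Delta> + real r * (real r - 3) / 2)"
proof -
  interpret graph G by fact
  let ?D = "2 * real n - 1 - real \<Delta> + real r * (real r - 3) / 2"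
  have ne: "verts G \<noteq> {}"
    using assms(2) by (auto simp: connected_def strongly_connected_def)
  then have n: "n \<ge> 1" using assms(3) by (simp add: Suc_le_eq card_gt_0_iff)
  have "\<Delta> \<in> out_degree G ` verts G"
    unfolding assms(6) max_degree_def using ne by (intro Max_in) auto
  then have "\<Delta> < n" using out_degree_less_card_verts assms(3) by auto
  moreover have "0 \<le> real r * (real r - 3) / 2" using assms(5) by simp
  \<comment> \<open>From \<Delta> < n follows 2n - 1 - \<Delta> > n - 1 \<ge> 0. Positivity lets the
    lower bound on the distance sum be inverted below.\<close>
  ultimately have D: "?D > 0" using n by linarith
  have "closeness G v \<le> (real n - 1) / ?D" if v: "v \<in> verts G" for v
  proof -
    have "r \<le> eccentricity G v"
      unfolding assms(4) radius_def using v by (intro Min_le) auto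
    moreover have "out_degree G v \<le> \<Delta>"
      unfolding assms(6) max_degree_def using v by (intro Max_ge) auto
    ultimately have "?D \<le> (\<Sum>w\<in>verts G. real (graph_dist G v w))"
      using sum_graph_dist_ge[OF assms(2) v, of r] assms(3,5) by simp
    then show ?thesis
      unfolding closeness_def assms(3)[symmetric] using D n by (intro divide_left_mono) auto
  qed
  \<comment> \<open>The bound does not depend on the vertex, so it passes to the average.\<close>
  then have "(\<Sum>v\<in>verts G. closeness G v) \<le> real n * ((real n - 1) / ?D)"
    unfolding assms(3) by (intro sum_bounded_above) simp
  then have "(1 / real n) * (\<Sum>v\<in>verts G. closeness G v) \<le> (1 / real n) * (real n * ((real n - 1) / ?D))"
    by (intro mult_left_mono) auto
  also have "\<dots> = (real n - 1) / ?D" using n by simp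
  finally show ?thesis unfolding graph_closeness_def assms(3) .
qed

end
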